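(* Let $m,n$ be positive integers and let $\mathcal{M}\in\mathbb{R}^{[2m,n]}$. The following statements are equivalent: (i) $\mathcal{M}$ is a $T$-$P$ tensor; (ii) $\mathcal{M}$ is $T$-column sufficient and $T$-non-degenerate.
   Context: Write $[n]=\{1,\dots,n\}$. $\mathbb{R}^{[m,n]}$ denotes the set of $m$-th order $n$-dimensional real tensors $\mathcal{Z}=(z_{i_1\ldots i_m})$ with $i_j\in[n]$ for $j\in[m]$; $\mathcal{O}$ is the zero tensor. For $\mathcal{M}=(m_{i_1\ldots i_{2m}})\in\mathbb{R}^{[2m,n]}$ and $\mathcal{Z}\in\mathbb{R}^{[m,n]}$, the tensor $\mathcal{M}\mathcal{Z}\in\mathbb{R}^{[m,n]}$ is defined by $(\mathcal{M}\mathcal{Z})_{i_1\ldots i_m}=\sum_{i_{m+1},\dots,i_{2m}=1}^n m_{i_1\ldots i_m i_{m+1}\ldots i_{2m}}z_{i_{m+1}\ldots i_{2m}}$. $\mathcal{M}\in\mathbb{R}^{[2m,n]}$ is: - $T$-column sufficient if for every $\mathcal{Z}\in\mathbb{R}^{[m,n]}$: if $z_{i_1\ldots i_m}(\mathcal{M}\mathcal{Z})_{i_1\ldots i_m}\le 0$ for all $i_1,\dots,i_m\in[n]$, then $z_{i_1\ldots i_m}(\mathcal{M}\mathcal{Z})_{i_1\ldots i_m}=0$ for all $i_1,\dots,i_m\in[n]$; - $T$-non-degenerate if for every $\mathcal{Z}\in\mathbb{R}^{[m,n]}\setminus\{\mathcal{O}\}$ there exist $i_1,\dots,i_m\in[n]$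 with $z_{i_1\ldots i_m}(\mathcal{M}\mathcal{Z})_{i_1\ldots i_m}\neq 0$; - a $T$-$P$ tensor if for every $\mathcal{Z}\in\mathbb{R}^{[m,n]}\setminus\{\mathcal{O}\}$ there exist $i_1,\dots,i_m\in[n]$ with $z_{i_1\ldots i_m}(\mathcal{M}\mathcal{Z})_{i_1\ldots i_m}>0$. *)

theory Defs
  imports Complex_Main
begin

(* The multi-indices (i_1, ..., i_k) in [n]^k, as lists of length k over [n] = {1..n}. *)
definition multi_indices :: "nat \<Rightarrow> nat \<Rightarrow> nat list set" where
  "multi_indices k n = {is. set is \<subseteq> {1..n} \<and> length is = k}"

(* Only the entries at indices in [n]^k matter; all other values are fixed to 0, so that
   equality of tensors is equality of functions. *)
definition tensors :: "nat \<Rightarrow> nat \<Rightarrow> (nat list \<Rightarrow> real) set" where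
  "tensors k n = {Z. \<forall>is. is \<notin> multi_indices k n \<longrightarrow> Z is = 0}"

definition zero_tensor :: "nat list \<Rightarrow> real" where
  "zero_tensor = (\<lambda>_. 0)"

definition tensor_mult :: "nat \<Rightarrow> nat \<Rightarrow> (nat list \<Rightarrow> real) \<Rightarrow> (nat list \<Rightarrow> real) \<Rightarrow> nat list \<Rightarrow> real" where
  "tensor_mult m n M Z =
     (\<lambda>is. if is \<in> multi_indices m n
           then \<Sum>js\<in>multi_indices m n. M (is @ js) * Z js
           else 0)"

(* In the three classes below m is half the order of M, which is not determined by M as a
   function on lists and hence is a parameter. *)
definition T_column_sufficient :: "nat \<Rightarrow> nat \<Rightarrow> (nat list \<Rightarrow> real) \<Rightarrow> bool" where
  "T_column_sufficient m n M \<longleftrightarrow> M \<in> tensors (2 * m) n \<and>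
     (\<forall>Z\<in>tensors m n.
        (\<forall>is\<in>multi_indices m n. Z is * tensor_mult m n M Z is \<le> 0) \<longrightarrow>
        (\<forall>is\<in>multi_indices m n. Z is * tensor_mult m n M Z is = 0))"

definition T_non_degenerate :: "nat \<Rightarrow> nat \<Rightarrow> (nat list \<Rightarrow> real) \<Rightarrow> bool" where
  "T_non_degenerate m n M \<longleftrightarrow> M \<in> tensors (2 * m) n \<and>
     (\<forall>Z\<in>tensors m n - {zero_tensor}.
        \<exists>is\<in>multi_indices m n. Z is * tensor_mult m n M Z is \<noteq> 0)"

definition T_P_tensor :: "nat \<Rightarrow> nat \<Rightarrow> (nat list \<Rightarrow> real) \<Rightarrow> bool" where
  "T_P_tensor m n M \<longleftrightarrow> M \<in> tensors (2 * m) n \<and>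
     (\<forall>Z\<in>tensors m n - {zero_tensor}.
        \<exists>is\<in>multi_indices m n. Z is * tensor_mult m n M Z is > 0)"

lemma finite_multi_indices: "finite (multi_indices k n)"
  unfolding multi_indices_def by (rule finite_lists_length_eq) simp

lemma zero_tensor_in_tensors: "zero_tensor \<in> tensors k n"
  by (simp add: zero_tensor_def tensors_def)

lemma append_in_multi_indices:
  "is \<in> multi_indices k n \<Longrightarrow> js \<in> multi_indices l n \<Longrightarrow> is @ js \<in> multi_indices (k + l) n"
  by (auto simp: multi_indices_def)

lemma tensor_mult_in_tensors: "tensor_mult m n M Z \<in> tensors m n"
  by (simp add: tensor_mult_def tensors_def)

end

theory Submission imports Defs begin

text \<open>
  Fix a tensor \<open>Z\<close> and look at the signs of the products \<open>z\<^sub>i (MZ)\<^sub>i\<close>. Being \<open>T\<close>-\<open>P\<close> says that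
  they can be all nonpositive only for \<open>Z = O\<close>, where they all vanish. The other two properties
  split this in two: column sufficiency leads from ``all nonpositive'' to ``all zero'', and
  non-degeneracy from ``all zero'' to \<open>Z = O\<close>.
\<close>

theorem theorem3p14:
  fixes m n :: nat and M :: "nat list \<Rightarrow> real"
  assumes "m > 0" and "n > 0" and "M \<in> tensors (2 * m) n"
  shows "T_P_tensor m n M \<longleftrightarrow> T_column_sufficient m n M \<and> T_non_degenerate m n M"
proof
  assume P: "T_P_tensor m n M"
  have "T_column_sufficient m n M"
    unfolding T_column_sufficient_def
  proof (intro conjI ballI impI assms(3))
    fix Z "is"
    assume Z: "Z \<in> tensors m n"
      and le: "\<forall>is\<in>multi_indices m n. Z is * tensor_mult m n M Z is \<le> 0"
    have "Z = zero_tensor"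
    proof (rule ccontr)
      assume "Z \<noteq> zero_tensor"
      with P Z obtain js where "js \<in> multi_indices m n" "Z js * tensor_mult m n M Z js > 0"
        unfolding T_P_tensor_def by blast
      with le show False by force
    qed
    then show "Z is * tensor_mult m n M Z is = 0"
      by (simp add: zero_tensor_def)
  qed
  moreover have "T_non_degenerate m n M"
    using P unfolding T_P_tensor_def T_non_degenerate_def by (metis less_irrefl)
  ultimately show "T_column_sufficient m n M \<and> T_non_degenerate m n M" ..
next
  assume "T_column_sufficient m n M \<and> T_non_degenerate m n M"
  then have suff: "T_column_sufficient m n M" and nondeg: "T_non_degenerate m n M"
    by auto
  show "T_P_tensor m n M"
    unfolding T_P_tensor_def
  proof (intro conjI ballI assms(3))
    fix Z assume Z: "Z \<in> tensors m n - {zero_tensor}"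
    show "\<exists>is\<in>multi_indices m n. Z is * tensor_mult m n M Z is > 0"
    proof (rule ccontr)
      assume "\<not> ?thesis"
      then have "\<forall>is\<in>multi_indices m n. Z is * tensor_mult m n M Z is \<le> 0"
        by (simp add: not_less)
      with suff Z have "\<forall>is\<in>multi_indices m n. Z is * tensor_mult m n M Z is = 0"
        unfolding T_column_sufficient_def by blast
      with nondeg Z show False
        unfolding T_non_degenerate_def by blast
    qed
  qed
qed

end
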